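(* Let $\mathbb{X}$ be a real Banach space and $\mathcal{B}=(e_n)_{n=1}^\infty$ a semi-normalized Schauder basis of $\mathbb{X}$. The following statements are equivalent: (i) $\mathcal{B}$ is greedy. (ii) There exists an absolute constant $C>0$ such that $\|x-\mathcal{G}_m(x)\|\le C\,\mathcal{D}^*_m(x)$ for all $x\in\mathbb{X}$ and all $m\in\mathbb{N}$. (iii) There exists an absolute constant $C>0$ such that $\|x-\mathcal{G}_m(x)\|\le C\,\mathcal{D}_m(x)$ for all $x\in\mathbb{X}$ and all $m\in\mathbb{N}$. (iv) $\mathcal{B}$ has Property $(Q)$ (with some constant). (v) $\mathcal{B}$ has Property $(Q^* )$ (with some constant). (vi) $\mathcal{B}$ is unconditional and democratic.
   Context: Setting: $\mathbb{X}$ is a real Banach space and $\mathcal{B}=(e_n)_{n=1}^\infty$ is a Schauder basis of $\mathbb{X}$ with biorthogonal functionals $(e_n^* )$, semi-normalized: $0<\inf_n\|e_n\|\le\sup_n\|e_n\|<\infty$. Here $\mathbb{N}=\{1,2,\dots\}$. Notation: $\mathrm{supp}(x)=\{n: e_n^*(x)\ne0\}$; $\mathbb{X}_c$ is the set of $x\in\mathbb{X}$ with finite support; $\|\tilde x\|_\infty=\sup_n|e_n^*(x)|$; $xy=0$ means $\mathrm{supp}(x)\cap\mathrm{supp}(y)=\emptyset$; $P_A(x)=\sum_{n\in A}e_n^*(x)e_n$; $|A|$ is the cardinality of $A$. For finite $A\subset\mathbb{N}$ and signs $\varepsilon=(\varepsilon_n)_{n\in A}\in\{\pm1\}^A$,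 $1_A=\sum_{n\in A}e_n$ and $1_{\varepsilon A}=\sum_{n\in A}\varepsilon_ne_n$ (with $1_\emptyset=0$); $[\,\cdot\,]$ denotes linear span and $d(x,V)=\inf_{v\in V}\|x-v\|$. Greedy sums: the natural greedy ordering of $x$ is the injective map $\rho:\mathbb{N}\to\mathbb{N}$ with $\mathrm{supp}(x)\subset\rho(\mathbb{N})$ such that if $j<k$ then either $|e^*_{\rho(j)}(x)|>|e^*_{\rho(k)}(x)|$, or $|e^*_{\rho(j)}(x)|=|e^*_{\rho(k)}(x)|$ and $\rho(j)<\rho(k)$; and $\mathcal{G}_m(x)=\sum_{j=1}^m e^*_{\rho(j)}(x)e_{\rho(j)}$. Errors: $\sigma_m(x)=\inf\{d(x,[e_n,n\in A]): A\subset\mathbb{N},|A|=m\}$; $\mathcal{D}_m(x)=\inf\{d(x,[1_A]): A\subset\mathbb{N},|A|=m\}$; $\mathcal{D}^*_m(x)=\inf\{d(x,[1_{\varepsilon A}]): \varepsilon\in\{\pm1\}^A, A\subset\mathbb{N},|A|=m\}$. $\mathcal{B}$ is greedy if there is $C\ge1$ with $\|x-\mathcal{G}_m(x)\|\le C\sigma_m(x)$ for all $x\in\mathbb{X}$, $m\in\mathbb{N}$. $\mathcal{B}$ is unconditional if there is $C>0$ with $\|P_A(x)\|\le C\|x\|$ for all $x\in\mathbb{X}$ and $A\subset\mathbb{N}$ (equivalently, every rearrangement of $\sum_n e_n^*(x)e_n$ converges to $x$ for every $x$). $\mathcal{B}$ is democratic if there is $D\ge1$ with $\|1_A\|\le D\|1_B\|$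 for all finite $A,B\subset\mathbb{N}$ with $|A|=|B|$. Property $(Q)$ with constant $C$: $\|x+1_A\|\le C\|x+y+1_B\|$ for all finite (possibly empty) $A,B\subset\mathbb{N}$ with $|A|=|B|$, $A\cap B=\emptyset$, and all $x,y\in\mathbb{X}_c$ with $xy=0$, $\|\tilde x\|_\infty\le1$ and $\mathrm{supp}(x+y)\cap(A\cup B)=\emptyset$. For $z\in\mathbb{X}_c$ let $\Gamma_0=\mathbb{X}_c$ and, for $z\neq0$, $\Gamma_z=\{y\in\mathbb{X}_c: zy=0,\ |\mathrm{supp}(z)|\le|\{n:|e_n^*(y)|=1\}|\}$. Property $(Q^* )$ with constant $C$: $\|x+z\|\le C\|x+y\|$ for all $x,z,y\in\mathbb{X}_c$ with $xz=0$, $xy=0$, $\max\{\|\tilde x\|_\infty,\|\tilde z\|_\infty\}\le1$ and $y\in\Gamma_z$. *)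

theory Defs
  imports "HOL-Analysis.Analysis"
begin

text \<open>
  The basis \<open>(e\<^sub>n)\<close> is a sequence \<open>e :: nat \<Rightarrow> 'a\<close>, indexed from \<open>0\<close> instead of \<open>1\<close>;
  the relabelling preserves the order of the index set.
\<close>

definition schauder_basis :: "(nat \<Rightarrow> 'a::real_normed_vector) \<Rightarrow> bool" where
  "schauder_basis e \<longleftrightarrow> (\<forall>x. \<exists>!a::nat \<Rightarrow> real. (\<lambda>n. a n *\<^sub>R e n) sums x)"

definition semi_normalized :: "(nat \<Rightarrow> 'a::real_normed_vector) \<Rightarrow> bool" where
  "semi_normalized e \<longleftrightarrow> 0 < (INF n. norm (e n)) \<and> bdd_above (range (\<lambda>n. norm (e n)))"

text \<open>The value \<open>e\<^sub>n\<^sup>*(x)\<close> of the biorthogonal functional; meaningful for Schauder bases only.\<close>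

definition coord :: "(nat \<Rightarrow> 'a::real_normed_vector) \<Rightarrow> nat \<Rightarrow> 'a \<Rightarrow> real" where
  "coord e n x = (THE a. (\<lambda>k. a k *\<^sub>R e k) sums x) n"

lemma coord_sums:
  assumes "schauder_basis e"
  shows "(\<lambda>n. coord e n x *\<^sub>R e n) sums x"
proof -
  have "\<exists>!a::nat \<Rightarrow> real. (\<lambda>n. a n *\<^sub>R e n) sums x"
    using assms unfolding schauder_basis_def by blast
  from theI'[OF this] show ?thesis
    unfolding coord_def .
qed

lemma coord_eqI:
  assumes "schauder_basis e" and "(\<lambda>n. a n *\<^sub>R e n) sums x"
  shows "coord e n x = a n"
  using assms coord_sums[OF assms(1), of x] unfolding schauder_basis_def by metis

lemma coord_basis:
  assumes "schauder_basis e"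
  shows "coord e n (e k) = (if n = k then 1 else 0)"
proof -
  have "(\<lambda>n. (if n = k then 1 else 0) *\<^sub>R e n) sums e k"
    using sums_single[of k e] by (simp add: if_distrib[of "\<lambda>c. c *\<^sub>R _"] cong: if_cong)
  from coord_eqI[OF assms this] show ?thesis .
qed

definition supp :: "(nat \<Rightarrow> 'a::real_normed_vector) \<Rightarrow> 'a \<Rightarrow> nat set" where
  "supp e x = {n. coord e n x \<noteq> 0}"

definition finsupp_vectors :: "(nat \<Rightarrow> 'a::real_normed_vector) \<Rightarrow> 'a set" where
  "finsupp_vectors e = {x. finite (supp e x)}"

definition disj_supp :: "(nat \<Rightarrow> 'a::real_normed_vector) \<Rightarrow> 'a \<Rightarrow> 'a \<Rightarrow> bool" where
  "disj_supp e x y \<longleftrightarrow> supp e x \<inter> supp e y = {}"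

definition coord_sup_norm :: "(nat \<Rightarrow> 'a::real_normed_vector) \<Rightarrow> 'a \<Rightarrow> real" where
  "coord_sup_norm e x = (SUP n. \<bar>coord e n x\<bar>)"

definition unit_sum :: "(nat \<Rightarrow> 'a::real_normed_vector) \<Rightarrow> nat set \<Rightarrow> 'a" where
  "unit_sum e A = (\<Sum>n\<in>A. e n)"

definition signed_unit_sum ::
    "(nat \<Rightarrow> 'a::real_normed_vector) \<Rightarrow> (nat \<Rightarrow> real) \<Rightarrow> nat set \<Rightarrow> 'a" where
  "signed_unit_sum e \<epsilon> A = (\<Sum>n\<in>A. \<epsilon> n *\<^sub>R e n)"

definition natural_greedy_ordering ::
    "(nat \<Rightarrow> 'a::real_normed_vector) \<Rightarrow> 'a \<Rightarrow> (nat \<Rightarrow> nat) \<Rightarrow> bool" where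
  "natural_greedy_ordering e x \<rho> \<longleftrightarrow>
     inj \<rho> \<and> supp e x \<subseteq> range \<rho> \<and>
     (\<forall>j k. j < k \<longrightarrow>
        \<bar>coord e (\<rho> j) x\<bar> > \<bar>coord e (\<rho> k) x\<bar> \<or>
        (\<bar>coord e (\<rho> j) x\<bar> = \<bar>coord e (\<rho> k) x\<bar> \<and> \<rho> j < \<rho> k))"

text \<open>
  A natural greedy ordering exists for a semi-normalized Schauder basis, since the coordinates of
  a vector tend to \<open>0\<close>. If \<open>x\<close> has finite support, orderings may differ, but only in the zero
  coordinates listed after the support, so the choice does not affect the greedy sum.
  The \<open>m\<close> leading positions are \<open>0, \<dots>, m - 1\<close>.
\<close>

definition greedy_sum ::
    "(nat \<Rightarrow> 'a::real_normed_vector) \<Rightarrow> nat \<Rightarrow> 'a \<Rightarrow> 'a" where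
  "greedy_sum e m x =
     (let \<rho> = (SOME \<rho>. natural_greedy_ordering e x \<rho>)
      in \<Sum>j<m. coord e (\<rho> j) x *\<^sub>R e (\<rho> j))"

definition best_error :: "(nat \<Rightarrow> 'a::real_normed_vector) \<Rightarrow> nat \<Rightarrow> 'a \<Rightarrow> real" where
  "best_error e m x =
     Inf {infdist x (span (e ` A)) | A. finite A \<and> card A = m}"

definition const_error :: "(nat \<Rightarrow> 'a::real_normed_vector) \<Rightarrow> nat \<Rightarrow> 'a \<Rightarrow> real" where
  "const_error e m x =
     Inf {infdist x (span {unit_sum e A}) | A. finite A \<and> card A = m}"

definition signed_const_error :: "(nat \<Rightarrow> 'a::real_normed_vector) \<Rightarrow> nat \<Rightarrow> 'a \<Rightarrow> real" where
  "signed_const_error e m x =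
     Inf {infdist x (span {signed_unit_sum e \<epsilon> A}) | \<epsilon> A.
            finite A \<and> card A = m \<and> (\<forall>n\<in>A. \<epsilon> n \<in> {1, -1})}"

definition greedy_basis :: "(nat \<Rightarrow> 'a::real_normed_vector) \<Rightarrow> bool" where
  "greedy_basis e \<longleftrightarrow>
     (\<exists>C\<ge>1. \<forall>x. \<forall>m\<ge>1. norm (x - greedy_sum e m x) \<le> C * best_error e m x)"

text \<open>
  For infinite \<open>A\<close> the series defining \<open>P\<^sub>A(x)\<close> is taken in the order of the basis. Its convergence
  is not automatic and is required explicitly in the definition of unconditionality.
\<close>

definition coord_proj_term ::
    "(nat \<Rightarrow> 'a::real_normed_vector) \<Rightarrow> nat set \<Rightarrow> 'a \<Rightarrow> nat \<Rightarrow> 'a" where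
  "coord_proj_term e A x n = (if n \<in> A then coord e n x *\<^sub>R e n else 0)"

definition coord_proj :: "(nat \<Rightarrow> 'a::real_normed_vector) \<Rightarrow> nat set \<Rightarrow> 'a \<Rightarrow> 'a" where
  "coord_proj e A x = (\<Sum>n. coord_proj_term e A x n)"

definition unconditional_basis :: "(nat \<Rightarrow> 'a::real_normed_vector) \<Rightarrow> bool" where
  "unconditional_basis e \<longleftrightarrow>
     (\<exists>C>0. \<forall>x A. summable (coord_proj_term e A x) \<and> norm (coord_proj e A x) \<le> C * norm x)"

definition democratic_basis :: "(nat \<Rightarrow> 'a::real_normed_vector) \<Rightarrow> bool" where
  "democratic_basis e \<longleftrightarrow>
     (\<exists>D\<ge>1. \<forall>A B. finite A \<and> finite B \<and> card A = card B \<longrightarrow>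
        norm (unit_sum e A) \<le> D * norm (unit_sum e B))"

definition property_Q :: "(nat \<Rightarrow> 'a::real_normed_vector) \<Rightarrow> real \<Rightarrow> bool" where
  "property_Q e C \<longleftrightarrow>
     (\<forall>A B. \<forall>x\<in>finsupp_vectors e. \<forall>y\<in>finsupp_vectors e.
        finite A \<and> finite B \<and> card A = card B \<and> A \<inter> B = {} \<and>
        disj_supp e x y \<and> coord_sup_norm e x \<le> 1 \<and> supp e (x + y) \<inter> (A \<union> B) = {} \<longrightarrow>
        norm (x + unit_sum e A) \<le> C * norm (x + y + unit_sum e B))"

definition Gamma_set :: "(nat \<Rightarrow> 'a::real_normed_vector) \<Rightarrow> 'a \<Rightarrow> 'a set" where
  "Gamma_set e z =
     (if z = 0 then finsupp_vectors e
      else {y \<in> finsupp_vectors e. disj_supp e z y \<and>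
              card (supp e z) \<le> card {n. \<bar>coord e n y\<bar> = 1}})"

definition property_Q_star :: "(nat \<Rightarrow> 'a::real_normed_vector) \<Rightarrow> real \<Rightarrow> bool" where
  "property_Q_star e C \<longleftrightarrow>
     (\<forall>x\<in>finsupp_vectors e. \<forall>z\<in>finsupp_vectors e. \<forall>y\<in>finsupp_vectors e.
        disj_supp e x z \<and> disj_supp e x y \<and>
        max (coord_sup_norm e x) (coord_sup_norm e z) \<le> 1 \<and> y \<in> Gamma_set e z \<longrightarrow>
        norm (x + z) \<le> C * norm (x + y))"

end

theory Submission
  imports Defs
begin

text \<open>
  It suffices to show (i) \<open>\<Rightarrow>\<close> (ii) \<open>\<Rightarrow>\<close> (iii) \<open>\<Rightarrow>\<close> (vi) \<open>\<Rightarrow>\<close> (i) and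
  (vi) \<open>\<Rightarrow>\<close> (v) \<open>\<Rightarrow>\<close> (iv) \<open>\<Rightarrow>\<close> (vi).
  Adding a large multiple of \<open>1\<^sub>B\<close> to \<open>x\<close> makes \<open>B\<close> the greedy set, so (iii) bounds
  \<open>x - P\<^sub>B x\<close> by \<open>x\<close>, uniformly in \<open>B\<close>; applied to \<open>1\<^sub>A + 2 1\<^sub>B\<close> it gives democracy for
  disjoint sets, and a third set disjoint from both removes the disjointness.
  The step (vi) \<open>\<Rightarrow>\<close> (i) is the argument of Konyagin and Temlyakov: the part of \<open>x - G\<^sub>m x\<close>
  on the approximating set is compared with the coordinates that the greedy sum
  picked outside that set.
  Bounds for the finite projections \<open>P\<^sub>F\<close> suffice throughout, so
  the boundedness of the coordinate functionals of a general Schauder basis is not needed.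
\<close>

section \<open>Orders with finite initial segments, and convexity over signs\<close>

text \<open>Counting predecessors gives each element of \<open>S\<close> a rank. Ranks increase
  strictly along the order and fill all of the naturals, so the inverse of the rank function is the
  enumeration. With the greedy order as \<open>lt\<close>, this produces natural greedy
  orderings.\<close>

lemma enumerate_finite_predecessors:
  fixes lt :: "'b \<Rightarrow> 'b \<Rightarrow> bool"
  assumes S: "infinite S" and fin: "\<And>n. n \<in> S \<Longrightarrow> finite {k \<in> S. lt k n}"
    and tr: "\<And>a b c. lt a b \<Longrightarrow> lt b c \<Longrightarrow> lt a c" and irr: "\<And>a. \<not> lt a a"
    and tot: "\<And>a b. a \<noteq> b \<Longrightarrow> lt a b \<or> lt b a"
  obtains \<rho> :: "nat \<Rightarrow> 'b" where "bij_betw \<rho> UNIV S" "\<And>j k. j < k \<Longrightarrow> lt (\<rho> j) (\<rho> k)"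
proof -
  define r where "r n = card {k \<in> S. lt k n}" for n
  have mono: "r a < r b" if "a \<in> S" "b \<in> S" "lt a b" for a b
  proof -
    have "a \<in> {k \<in> S. lt k b} - {k \<in> S. lt k a}" using that irr by simp
    moreover have "{k \<in> S. lt k a} \<subseteq> {k \<in> S. lt k b}" using that tr by blast
    ultimately show ?thesis unfolding r_def using that by (intro psubset_card_mono fin) auto
  qed
  have inj: "inj_on r S"
    by (rule inj_onI) (metis mono tot less_irrefl)
  have "r ` S = UNIV"
  proof (intro equalityI subset_UNIV subsetI)
    fix N :: nat
    have "infinite (r ` S)" using S inj by (simp add: finite_image_iff)
    then obtain n where n: "n \<in> S" "N < r n"
      by (metis infinite_nat_iff_unbounded imageE)
    \<comment> \<open>The \<open>r n\<close> predecessors of \<open>n\<close> have distinct ranks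
      below \<open>r n\<close>, so these ranks are exactly the numbers below \<open>r n\<close>, and
      \<open>N\<close> is one of them.\<close>
    let ?P = "{k \<in> S. lt k n}"
    have "r ` ?P \<subseteq> {..<r n}" using mono n by auto
    moreover have "card (r ` ?P) = r n"
      using card_image[of r ?P] inj inj_on_subset[of r S ?P] by (auto simp: r_def)
    ultimately have "r ` ?P = {..<r n}" by (intro card_subset_eq) auto
    then show "N \<in> r ` S" using n(2) by blast
  qed
  then have bij: "bij_betw r S UNIV" using inj by (simp add: bij_betw_def)
  show thesis
  proof (rule that[of "inv_into S r"])
    show b: "bij_betw (inv_into S r) UNIV S" by (rule bij_betw_inv_into[OF bij])
    fix j k :: nat assume "j < k"
    define p q where "p = inv_into S r j" and "q = inv_into S r k"
    have pq: "p \<in> S" "q \<in> S" "r p = j" "r q = k"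
      unfolding p_def q_def using b bij \<open>r ` S = UNIV\<close>
      by (auto simp: bij_betw_def f_inv_into_f intro!: inv_into_into)
    with \<open>j < k\<close> mono[of q p] tot[of p q] show "lt (inv_into S r j) (inv_into S r k)"
      unfolding p_def[symmetric] q_def[symmetric] by auto
  qed
qed

text \<open>A vector with coefficients in [-1, 1] is a convex combination of vectors with
  coefficients 1 and -1, and balls are convex. The induction removes one coefficient at a time; the
  offset \<open>v\<close> absorbs the terms whose signs are already fixed.\<close>

lemma norm_sum_scaleR_le_signs:
  fixes w :: "'b \<Rightarrow> 'a::real_normed_vector"
  assumes "finite F"
    and "\<And>\<epsilon>. (\<And>n. \<epsilon> n \<in> {1, -1}) \<Longrightarrow> norm (v + (\<Sum>n\<in>F. \<epsilon> n *\<^sub>R w n)) \<le> M"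
    and "\<And>n. n \<in> F \<Longrightarrow> \<bar>l n\<bar> \<le> 1"
  shows "norm (v + (\<Sum>n\<in>F. l n *\<^sub>R w n)) \<le> M"
  using assms
proof (induction F arbitrary: v rule: finite_induct)
  case empty
  from empty(1)[of "\<lambda>_. 1"] show ?case by simp
next
  case (insert k F)
  let ?s = "\<Sum>n\<in>F. l n *\<^sub>R w n"
  have ext: "norm ((v + c *\<^sub>R w k) + ?s) \<le> M" if c: "c \<in> {1, -1}" for c :: real
  proof (rule insert.IH)
    fix \<epsilon> :: "'b \<Rightarrow> real" assume eps: "\<And>n. \<epsilon> n \<in> {1, -1}"
    have "(\<Sum>n\<in>F. (\<epsilon>(k := c)) n *\<^sub>R w n) = (\<Sum>n\<in>F. \<epsilon> n *\<^sub>R w n)"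
      using insert.hyps by (intro sum.cong) auto
    moreover have "norm (v + (\<Sum>n\<in>insert k F. (\<epsilon>(k := c)) n *\<^sub>R w n)) \<le> M"
      using eps c by (intro insert.prems(1)) simp
    ultimately show "norm ((v + c *\<^sub>R w k) + (\<Sum>n\<in>F. \<epsilon> n *\<^sub>R w n)) \<le> M"
      using insert.hyps by (simp add: add.assoc)
  qed (use insert.prems in auto)
  \<comment> \<open>The weight that writes \<open>l k\<close> as a convex combination of 1 and
    -1.\<close>
  define t where "t = (1 + l k) / 2"
  have t: "0 \<le> t" "t \<le> 1" "l k = t - (1 - t)" using insert.prems(2)[of k] by (auto simp: t_def)
  have "(2 * t) *\<^sub>R w k = t *\<^sub>R w k + t *\<^sub>R w k" by (simp only: mult_2 scaleR_add_left)
  then have "v + (\<Sum>n\<in>insert k F. l n *\<^sub>R w n)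
      = t *\<^sub>R ((v + 1 *\<^sub>R w k) + ?s) + (1 - t) *\<^sub>R ((v + (-1) *\<^sub>R w k) + ?s)"
    using insert.hyps by (simp add: t(3) algebra_simps)
  also have "norm \<dots> \<le> t * M + (1 - t) * M"
    using t ext[of 1] ext[of "-1"]
    by (intro norm_triangle_le add_mono) (auto intro!: mult_left_mono)
  finally show ?case by (simp add: algebra_simps)
qed

section \<open>Finite projections, suprema of coordinates, and democracy from disjoint sets\<close>

definition fin_proj :: "(nat \<Rightarrow> 'a::real_normed_vector) \<Rightarrow> nat set \<Rightarrow> 'a \<Rightarrow> 'a" where
  "fin_proj e F x = (\<Sum>n\<in>F. coord e n x *\<^sub>R e n)"

text \<open>The finite form of unconditionality: in a Banach space, a Schauder basis is
  unconditional exactly when this holds for some \<open>K\<close>. Restricting to finite sets keeps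
  convergence questions out of the estimates.\<close>

definition bounded_fin_proj :: "(nat \<Rightarrow> 'a::real_normed_vector) \<Rightarrow> real \<Rightarrow> bool" where
  "bounded_fin_proj e K \<longleftrightarrow> (\<forall>F x. finite F \<longrightarrow> norm (fin_proj e F x) \<le> K * norm x)"

lemma bounded_fin_projD:
  "bounded_fin_proj e K \<Longrightarrow> finite F \<Longrightarrow> norm (fin_proj e F x) \<le> K * norm x"
  unfolding bounded_fin_proj_def by blast

lemma fin_proj_eq_0: "supp e x \<inter> F = {} \<Longrightarrow> fin_proj e F x = 0"
  unfolding fin_proj_def supp_def by (intro sum.neutral) auto

lemma fin_proj_Un:
  "finite F \<Longrightarrow> finite G \<Longrightarrow> F \<inter> G = {} \<Longrightarrow> fin_proj e (F \<union> G) x = fin_proj e F x + fin_proj e G x"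
  unfolding fin_proj_def by (rule sum.union_disjoint)

text \<open>A real \<open>SUP\<close> can be estimated only over a bounded family; finite support
  supplies the bound behind \<open>coord_sup_norm\<close>.\<close>

lemma bdd_above_coord: "bdd_above (range (\<lambda>n. \<bar>coord e n x\<bar>))" if "finite (supp e x)"
proof (rule bdd_aboveI2)
  fix n show "\<bar>coord e n x\<bar> \<le> (\<Sum>k\<in>supp e x. \<bar>coord e k x\<bar>)"
    using that member_le_sum[of n "supp e x" "\<lambda>k. \<bar>coord e k x\<bar>"]
    by (cases "n \<in> supp e x") (auto simp: supp_def sum_nonneg)
qed

lemma abs_coord_le_coord_sup_norm:
  "x \<in> finsupp_vectors e \<Longrightarrow> \<bar>coord e n x\<bar> \<le> coord_sup_norm e x"
  unfolding coord_sup_norm_def finsupp_vectors_def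
  by (rule cSUP_upper) (auto intro: bdd_above_coord)

lemma coord_sup_norm_le: "(\<And>n. \<bar>coord e n x\<bar> \<le> c) \<Longrightarrow> coord_sup_norm e x \<le> c"
  unfolding coord_sup_norm_def by (rule cSUP_least) auto

lemma unit_sum_eq: "unit_sum e A = (\<Sum>n\<in>A. 1 *\<^sub>R e n)"
  by (simp add: unit_sum_def)

lemma finite_set_of_card_disjoint:
  assumes "finite (F :: nat set)"
  obtains E where "finite E" "card E = m" "E \<inter> F = {}"
proof -
  have "infinite (- F)" using assms by (simp add: finite_compl)
  then obtain E where "E \<subseteq> - F" "finite E" "card E = m"
    using infinite_arbitrarily_large by blast
  then show thesis using that by blast
qed

lemma democratic_basisI_disjoint:
  assumes "D > 0"
    and dis: "\<And>A B. finite A \<Longrightarrow> finite B \<Longrightarrow> card A = card B \<Longrightarrow> A \<inter> B = {}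
      \<Longrightarrow> norm (unit_sum e A) \<le> D * norm (unit_sum e B)"
  shows "democratic_basis e"
proof -
  \<comment> \<open>The square comes from passing from \<open>A\<close> to \<open>E\<close> and from
    \<open>E\<close> to \<open>B\<close>; the maximum with 1 is there because democracy asks for a
    constant of at least 1.\<close>
  have "norm (unit_sum e A) \<le> max 1 (D * D) * norm (unit_sum e B)"
    if AB: "finite A" "finite B" "card A = card B" for A B
  proof -
    obtain E where E: "finite E" "card E = card A" "E \<inter> (A \<union> B) = {}"
      using finite_set_of_card_disjoint[of "A \<union> B" "card A"] AB by auto
    have "norm (unit_sum e A) \<le> D * norm (unit_sum e E)" using E AB by (intro dis) auto
    also have "\<dots> \<le> D * (D * norm (unit_sum e B))"
      using E AB \<open>D > 0\<close> by (intro mult_left_mono dis) auto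
    also have "\<dots> \<le> max 1 (D * D) * norm (unit_sum e B)"
      unfolding mult.assoc[symmetric] by (intro mult_right_mono) auto
    finally show ?thesis .
  qed
  then show ?thesis unfolding democratic_basis_def by (intro exI[of _ "max 1 (D * D)"]) auto
qed

section \<open>Coordinates and finite projections\<close>

context
  fixes e :: "nat \<Rightarrow> 'a::real_normed_vector"
  assumes sb: "schauder_basis e"
begin

lemma coord_add: "coord e n (x + y) = coord e n x + coord e n y"
  using sums_add[OF coord_sums[OF sb, of x] coord_sums[OF sb, of y]]
  by (intro coord_eqI[OF sb]) (simp add: scaleR_add_left)

lemma coord_scaleR: "coord e n (c *\<^sub>R x) = c * coord e n x"
  using bounded_linear.sums[OF bounded_linear_scaleR_right coord_sums[OF sb, of x], of c]
  by (intro coord_eqI[OF sb]) simp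

lemma coord_zero [simp]: "coord e n 0 = 0"
  using coord_scaleR[of n 0 0] by simp

lemma coord_diff: "coord e n (x - y) = coord e n x - coord e n y"
  using coord_add[of n x "(-1) *\<^sub>R y"] coord_scaleR[of n "-1" y] by simp

lemma coord_sum: "finite F \<Longrightarrow> coord e n (\<Sum>k\<in>F. f k) = (\<Sum>k\<in>F. coord e n (f k))"
  by (induction F rule: finite_induct) (auto simp: coord_add)

lemma coord_sum_scaleR:
  assumes "finite F"
  shows "coord e n (\<Sum>k\<in>F. a k *\<^sub>R e k) = (if n \<in> F then a n else 0)"
proof -
  have "coord e n (\<Sum>k\<in>F. a k *\<^sub>R e k) = (\<Sum>k\<in>F. coord e n (a k *\<^sub>R e k))"
    using assms by (rule coord_sum)
  also have "\<dots> = (\<Sum>k\<in>F. if n = k then a k else 0)"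
    by (intro sum.cong) (auto simp: coord_scaleR coord_basis[OF sb])
  finally show ?thesis using assms by simp
qed

lemma coord_unit_sum: "finite F \<Longrightarrow> coord e n (unit_sum e F) = (if n \<in> F then 1 else 0)"
  unfolding unit_sum_eq by (rule coord_sum_scaleR)

lemma coord_fin_proj: "finite F \<Longrightarrow> coord e n (fin_proj e F x) = (if n \<in> F then coord e n x else 0)"
  unfolding fin_proj_def by (rule coord_sum_scaleR)

lemma fin_proj_eq_self:
  assumes "finite F" "supp e x \<subseteq> F"
  shows "fin_proj e F x = x"
proof -
  have "(\<lambda>n. coord e n x *\<^sub>R e n) sums fin_proj e F x"
    unfolding fin_proj_def using assms by (intro sums_finite) (auto simp: supp_def)
  then show ?thesis using coord_sums[OF sb] sums_unique2 by blast
qed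

lemma fin_proj_add: "fin_proj e F (x + y) = fin_proj e F x + fin_proj e F y"
  by (simp add: fin_proj_def coord_add scaleR_add_left sum.distrib)

lemma fin_proj_diff: "fin_proj e F (x - y) = fin_proj e F x - fin_proj e F y"
  by (simp add: fin_proj_def coord_diff scaleR_diff_left sum_subtractf)

lemma supp_zero [simp]: "supp e 0 = {}"
  by (simp add: supp_def)

lemma supp_unit_sum: "finite F \<Longrightarrow> supp e (unit_sum e F) = F"
  by (auto simp: supp_def coord_unit_sum)

lemma supp_fin_proj: "finite F \<Longrightarrow> supp e (fin_proj e F x) = supp e x \<inter> F"
  by (auto simp: supp_def coord_fin_proj)

lemma supp_add_subset: "supp e (x + y) \<subseteq> supp e x \<union> supp e y"
  by (auto simp: supp_def coord_add)

lemma supp_add_disjoint: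
  assumes "disj_supp e x y"
  shows "supp e (x + y) = supp e x \<union> supp e y"
proof (intro set_eqI)
  fix n
  have "coord e n x = 0 \<or> coord e n y = 0" using assms by (auto simp: disj_supp_def supp_def)
  then show "n \<in> supp e (x + y) \<longleftrightarrow> n \<in> supp e x \<union> supp e y"
    by (auto simp: supp_def coord_add)
qed

lemma supp_span_subset:
  assumes "v \<in> span (e ` A)"
  shows "supp e v \<subseteq> A"
proof -
  have "coord e n v = 0" if "n \<notin> A" for n
    using assms
  proof (induction rule: span_induct)
    case base
    show ?case by (auto simp: subspace_def coord_add coord_scaleR)
  next
    case (step x)
    then show ?case using that by (auto simp: coord_basis[OF sb])
  qed
  then show ?thesis by (auto simp: supp_def)
qed

text \<open>Changing signs turns a sum \<open>s\<close> into a difference of two of its projections,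
  which costs the factor \<open>2 * K\<close>. The coefficients \<open>b n / a n\<close> lie in
  [-1, 1], so convexity reduces the general case to signs.\<close>

lemma norm_sum_le_dominated:
  assumes K: "bounded_fin_proj e K" and F: "finite F"
    and ab: "\<And>n. n \<in> F \<Longrightarrow> \<bar>b n\<bar> \<le> \<bar>a n\<bar>"
  shows "norm (\<Sum>n\<in>F. b n *\<^sub>R e n) \<le> 2 * K * norm (\<Sum>n\<in>F. a n *\<^sub>R e n)"
proof -
  define s where "s = (\<Sum>n\<in>F. a n *\<^sub>R e n)"
  \<comment> \<open>Where \<open>a n = 0\<close> the quotient is 0 by convention; there
    \<open>b n = 0\<close> as well, so the sum is unaffected.\<close>
  have "norm (0 + (\<Sum>n\<in>F. (b n / a n) *\<^sub>R (a n *\<^sub>R e n))) \<le> 2 * K * norm s"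
  proof (rule norm_sum_scaleR_le_signs[OF F])
    fix \<epsilon> :: "nat \<Rightarrow> real" assume eps: "\<And>n. \<epsilon> n \<in> {1, -1}"
    define G H where "G = {n\<in>F. \<epsilon> n = 1}" and "H = {n\<in>F. \<epsilon> n = -1}"
    have fin: "finite G" "finite H" using F by (auto simp: G_def H_def)
    have co: "coord e n s = a n" if "n \<in> F" for n
      unfolding s_def using F that by (simp add: coord_sum_scaleR)
    have FGH: "F = G \<union> H" "G \<inter> H = {}" using eps by (auto simp: G_def H_def)
    have "(\<Sum>n\<in>F. \<epsilon> n *\<^sub>R (a n *\<^sub>R e n))
        = (\<Sum>n\<in>G. \<epsilon> n *\<^sub>R (a n *\<^sub>R e n)) + (\<Sum>n\<in>H. \<epsilon> n *\<^sub>R (a n *\<^sub>R e n))"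
      unfolding FGH(1) using fin FGH(2) by (rule sum.union_disjoint)
    also have "(\<Sum>n\<in>G. \<epsilon> n *\<^sub>R (a n *\<^sub>R e n)) = fin_proj e G s"
      unfolding fin_proj_def by (intro sum.cong) (auto simp: G_def co)
    also have "(\<Sum>n\<in>H. \<epsilon> n *\<^sub>R (a n *\<^sub>R e n)) = - fin_proj e H s"
      unfolding fin_proj_def sum_negf[symmetric] by (intro sum.cong) (auto simp: H_def co)
    also have "norm (fin_proj e G s + - fin_proj e H s) \<le> K * norm s + K * norm s"
      using fin by (intro norm_triangle_le add_mono) (auto intro: bounded_fin_projD[OF K])
    finally show "norm (0 + (\<Sum>n\<in>F. \<epsilon> n *\<^sub>R (a n *\<^sub>R e n))) \<le> 2 * K * norm s" by simp
  next
    fix n assume "n \<in> F"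
    then show "\<bar>b n / a n\<bar> \<le> 1" using ab[of n] by (simp add: abs_divide divide_le_eq_1)
  qed
  also have "0 + (\<Sum>n\<in>F. (b n / a n) *\<^sub>R (a n *\<^sub>R e n)) = (\<Sum>n\<in>F. b n *\<^sub>R e n)"
  proof -
    have "b n = 0" if "n \<in> F" "a n = 0" for n using ab[OF that(1)] that(2) by simp
    then show ?thesis by (auto intro!: sum.cong)
  qed
  finally show ?thesis unfolding s_def .
qed

text \<open>The common core of (vi) \<open>\<Rightarrow>\<close> (i) and (vi) \<open>\<Rightarrow>\<close> (v).\<close>

lemma norm_fin_proj_exchange:
  assumes K: "bounded_fin_proj e K" "K > 0"
    and D: "\<And>A B. finite A \<Longrightarrow> finite B \<Longrightarrow> card A = card B
      \<Longrightarrow> norm (unit_sum e A) \<le> D * norm (unit_sum e B)" "D > 0"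
    and fin: "finite A" "finite B" "card A = card B" and t: "0 \<le> t"
    and small: "\<And>n. n \<in> A \<Longrightarrow> \<bar>coord e n x\<bar> \<le> t"
    and large: "\<And>n. n \<in> B \<Longrightarrow> t \<le> \<bar>coord e n y\<bar>"
  shows "norm (fin_proj e A x) \<le> 4 * K^3 * D * norm y"
proof -
  have sum_t: "norm (\<Sum>n\<in>F. t *\<^sub>R e n) = t * norm (unit_sum e F)" for F
    using t by (simp add: unit_sum_def flip: scaleR_sum_right)
  \<comment> \<open>The coordinates of \<open>x\<close> on \<open>A\<close> are raised to
    \<open>t\<close>, \<open>A\<close> is exchanged for \<open>B\<close>, and \<open>t\<close> is
    raised to the coordinates of \<open>y\<close> on \<open>B\<close>, with factors
    \<open>2 * K\<close>, \<open>D\<close> and \<open>2 * K\<close>. A last factor \<open>K\<close>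
    projects \<open>y\<close> onto \<open>B\<close>.\<close>
  have "norm (fin_proj e A x) \<le> 2 * K * (t * norm (unit_sum e A))"
    unfolding fin_proj_def sum_t[symmetric]
    using small t fin by (intro norm_sum_le_dominated[OF K(1)]) auto
  also have "\<dots> \<le> 2 * K * (D * (t * norm (unit_sum e B)))"
    using mult_left_mono[OF D(1)[OF fin] t] K(2)
    by (intro mult_left_mono) (auto simp: mult_ac)
  also have "t * norm (unit_sum e B) \<le> 2 * K * norm (fin_proj e B y)"
    unfolding fin_proj_def sum_t[symmetric]
    using large t fin by (intro norm_sum_le_dominated[OF K(1)]) auto
  also have "norm (fin_proj e B y) \<le> K * norm y"
    by (rule bounded_fin_projD[OF K(1) fin(2)])
  finally show ?thesis using K(2) D(2) by (simp add: power3_eq_cube mult_ac)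
qed

text \<open>The partial sums of the expansion of \<open>x\<close> have finite support and converge
  to \<open>x\<close>, while their projections onto \<open>F\<close> are eventually equal to that of
  \<open>x\<close>. So the bound passes to the limit. This serves property (Q), which speaks of
  finitely supported vectors.\<close>

lemma bounded_fin_projI_finsupp:
  assumes C: "C \<ge> 0"
    and le: "\<And>F x. finite F \<Longrightarrow> x \<in> finsupp_vectors e \<Longrightarrow> norm (fin_proj e F x) \<le> C * norm x"
  shows "bounded_fin_proj e C"
  unfolding bounded_fin_proj_def
proof (intro allI impI)
  fix F :: "nat set" and x assume F: "finite F"
  define s where "s N = fin_proj e {..<N} x" for N
  have lim: "s \<longlonglongrightarrow> x"
    using coord_sums[OF sb, of x] unfolding s_def fin_proj_def sums_def .
  obtain N0 where N0: "F \<subseteq> {..<N0}" using F finite_nat_iff_bounded by auto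
  have "\<forall>\<^sub>F N in sequentially. norm (fin_proj e F x) \<le> C * norm (s N)"
  proof (rule eventually_sequentiallyI[of N0])
    fix N assume "N0 \<le> N"
    then have "fin_proj e F (s N) = fin_proj e F x"
      unfolding fin_proj_def[of e F] using N0 by (intro sum.cong) (auto simp: s_def coord_fin_proj)
    moreover have "norm (fin_proj e F (s N)) \<le> C * norm (s N)"
      using F by (intro le) (auto simp: s_def finsupp_vectors_def supp_fin_proj)
    ultimately show "norm (fin_proj e F x) \<le> C * norm (s N)" by simp
  qed
  moreover have "(\<lambda>N. C * norm (s N)) \<longlonglongrightarrow> C * norm x"
    by (intro tendsto_intros lim)
  ultimately show "norm (fin_proj e F x) \<le> C * norm x"
    by (intro tendsto_lowerbound[where F = sequentially]) auto
qed

end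

section \<open>Unconditionality and bounded finite projections\<close>

lemma unconditional_basis_imp_bounded_fin_proj:
  assumes "unconditional_basis e"
  obtains K where "K > 0" "bounded_fin_proj e K"
proof -
  obtain K where K: "K > 0" "\<And>x A. norm (coord_proj e A x) \<le> K * norm x"
    using assms unfolding unconditional_basis_def by blast
  have "coord_proj e F x = fin_proj e F x" if "finite F" for F x
  proof -
    have "coord_proj e F x = sum (coord_proj_term e F x) F"
      unfolding coord_proj_def using that
      by (intro suminf_finite) (auto simp: coord_proj_term_def)
    also have "\<dots> = fin_proj e F x"
      unfolding fin_proj_def by (intro sum.cong) (auto simp: coord_proj_term_def)
    finally show ?thesis .
  qed
  then have "bounded_fin_proj e K"
    unfolding bounded_fin_proj_def using K(2) by metis
  with K(1) that show thesis by blast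
qed

text \<open>Blocks of the series for P_A(x) are controlled by the same blocks of the series for
  \<open>x\<close>, so the series is Cauchy and completeness gives its sum. The norm bound is the
  limit of the bounds for partial sums.\<close>

lemma bounded_fin_proj_imp_unconditional_basis:
  fixes e :: "nat \<Rightarrow> 'a::banach"
  assumes sb: "schauder_basis e" and K: "bounded_fin_proj e K"
  shows "unconditional_basis e"
proof -
  \<comment> \<open>Makes positivity immediate, both for the division by \<open>K'\<close> below and
    for the constant of unconditionality.\<close>
  define K' where "K' = max 1 K"
  have "norm (fin_proj e F x) \<le> K' * norm x" if "finite F" for F x
  proof -
    have "norm (fin_proj e F x) \<le> K * norm x" using bounded_fin_projD[OF K that] .
    also have "\<dots> \<le> K' * norm x" unfolding K'_def by (intro mult_right_mono) auto
    finally show ?thesis .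
  qed
  then have K': "K' > 0" "bounded_fin_proj e K'"
    by (simp_all add: bounded_fin_proj_def K'_def)
  \<comment> \<open>Projecting first onto \<open>I\<close> and then onto \<open>A \<inter> I\<close>
    bounds a block by a block. A bound by \<open>x\<close> itself would not become small, as the
    Cauchy criterion requires.\<close>
  have partial: "(\<Sum>n\<in>I. coord_proj_term e A x n) = fin_proj e (A \<inter> I) (fin_proj e I x)"
    if "finite I" for I A x
  proof -
    have "(\<Sum>n\<in>I. coord_proj_term e A x n) = (\<Sum>n\<in>I \<inter> A. coord e n x *\<^sub>R e n)"
      using that by (simp add: coord_proj_term_def sum.inter_restrict)
    then show ?thesis
      unfolding fin_proj_def[of e "A \<inter> I"] using that
      by (auto simp: coord_fin_proj[OF sb] intro!: sum.cong)
  qed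
  have summ: "summable (coord_proj_term e A x)" for A x
    unfolding summable_Cauchy
  proof (intro allI impI)
    fix r :: real assume "r > 0"
    then have "r / K' > 0" using K' by simp
    with sums_summable[OF coord_sums[OF sb, of x], unfolded summable_Cauchy]
    obtain N where N: "\<And>m n. m \<ge> N \<Longrightarrow> norm (\<Sum>n=m..<n. coord e n x *\<^sub>R e n) < r / K'" by blast
    have "norm (\<Sum>n=m..<n. coord_proj_term e A x n) < r" if "m \<ge> N" for m n
    proof -
      have "norm (\<Sum>n=m..<n. coord_proj_term e A x n) \<le> K' * norm (fin_proj e {m..<n} x)"
        by (simp add: partial bounded_fin_projD[OF K'(2)])
      also have "\<dots> < K' * (r / K')"
        using N[OF that] K'(1) unfolding fin_proj_def by (intro mult_strict_left_mono)
      finally show ?thesis using K' by simp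
    qed
    then show "\<exists>N. \<forall>m\<ge>N. \<forall>n. norm (\<Sum>n=m..<n. coord_proj_term e A x n) < r" by blast
  qed
  have "norm (coord_proj e A x) \<le> K' * norm x" for A x
  proof (rule tendsto_le[OF sequentially_bot])
    show "(\<lambda>N. norm (\<Sum>n<N. coord_proj_term e A x n)) \<longlonglongrightarrow> norm (coord_proj e A x)"
      unfolding coord_proj_def by (intro tendsto_norm summable_LIMSEQ summ)
    have "(\<lambda>N. fin_proj e {..<N} x) \<longlonglongrightarrow> x"
      using coord_sums[OF sb, of x] unfolding fin_proj_def sums_def .
    then show "(\<lambda>N. K' * norm (fin_proj e {..<N} x)) \<longlonglongrightarrow> K' * norm x"
      by (intro tendsto_intros)
    show "\<forall>\<^sub>F N in sequentially.
        norm (\<Sum>n<N. coord_proj_term e A x n) \<le> K' * norm (fin_proj e {..<N} x)"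
      by (simp add: partial bounded_fin_projD[OF K'(2)])
  qed
  with K'(1) summ show ?thesis unfolding unconditional_basis_def by blast
qed

section \<open>Errors of approximation\<close>

lemma const_error_le:
  assumes "finite B" "card B = m"
  shows "const_error e m x \<le> norm (x - c *\<^sub>R unit_sum e B)"
proof -
  have "const_error e m x \<le> infdist x (span {unit_sum e B})"
    unfolding const_error_def using assms
    by (intro cInf_lower bdd_belowI[of _ 0]) (auto simp: infdist_nonneg)
  also have "\<dots> \<le> dist x (c *\<^sub>R unit_sum e B)"
    by (intro infdist_le span_scale span_base) simp
  finally show ?thesis by (simp add: dist_norm)
qed

lemma signed_const_error_le_const_error: "signed_const_error e m x \<le> const_error e m x"
  unfolding const_error_def
proof (rule cInf_greatest)
  \<comment> \<open>The infimum of an empty set of reals is unspecified, so the family must be shown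
    to be nonempty.\<close>
  obtain A :: "nat set" where "finite A" "card A = m"
    using finite_set_of_card_disjoint[of "{}"] by auto
  then show "{infdist x (span {unit_sum e A}) |A. finite A \<and> card A = m} \<noteq> {}" by blast
  fix d assume "d \<in> {infdist x (span {unit_sum e A}) |A. finite A \<and> card A = m}"
  then obtain A where A: "finite A" "card A = m" "d = infdist x (span {unit_sum e A})" by blast
  have "unit_sum e A = signed_unit_sum e (\<lambda>_. 1) A"
    by (simp add: unit_sum_def signed_unit_sum_def)
  with A show "signed_const_error e m x \<le> d"
    unfolding signed_const_error_def
    by (intro cInf_lower bdd_belowI[of _ 0]) (auto simp: infdist_nonneg intro!: exI[of _ "\<lambda>_. 1"])
qed

lemma best_error_le_signed_const_error: "best_error e m x \<le> signed_const_error e m x"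
  unfolding signed_const_error_def
proof (rule cInf_greatest)
  obtain A :: "nat set" where "finite A" "card A = m"
    using finite_set_of_card_disjoint[of "{}"] by auto
  then show "{infdist x (span {signed_unit_sum e \<epsilon> A}) |\<epsilon> A.
      finite A \<and> card A = m \<and> (\<forall>n\<in>A. \<epsilon> n \<in> {1, -1})} \<noteq> {}"
    by (auto intro!: exI[of _ "\<lambda>_. 1"])
  fix d assume "d \<in> {infdist x (span {signed_unit_sum e \<epsilon> A}) |\<epsilon> A.
      finite A \<and> card A = m \<and> (\<forall>n\<in>A. \<epsilon> n \<in> {1, -1})}"
  then obtain \<epsilon> A where A: "finite A" "card A = m" "d = infdist x (span {signed_unit_sum e \<epsilon> A})"
    by blast
  have "signed_unit_sum e \<epsilon> A \<in> span (e ` A)"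
    unfolding signed_unit_sum_def by (intro span_sum span_scale span_base imageI)
  then have sub: "span {signed_unit_sum e \<epsilon> A} \<subseteq> span (e ` A)"
    by (intro span_minimal subspace_span) simp
  have "best_error e m x \<le> infdist x (span (e ` A))"
    unfolding best_error_def using A
    by (intro cInf_lower bdd_belowI[of _ 0]) (auto simp: infdist_nonneg)
  also have "\<dots> \<le> infdist x (span {signed_unit_sum e \<epsilon> A})"
    by (rule infdist_mono[OF sub]) (use span_zero in blast)
  finally show "best_error e m x \<le> d" using A by simp
qed

lemma le_best_errorI:
  assumes "\<And>A v. finite A \<Longrightarrow> card A = m \<Longrightarrow> v \<in> span (e ` A) \<Longrightarrow> c \<le> norm (x - v)"
  shows "c \<le> best_error e m x"
  unfolding best_error_def
proof (rule cInf_greatest)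
  obtain A :: "nat set" where "finite A" "card A = m"
    using finite_set_of_card_disjoint[of "{}"] by auto
  then show "{infdist x (span (e ` A)) |A. finite A \<and> card A = m} \<noteq> {}" by blast
  fix d assume "d \<in> {infdist x (span (e ` A)) |A. finite A \<and> card A = m}"
  then obtain A where A: "finite A" "card A = m" "d = infdist x (span (e ` A))" by blast
  have ne: "span (e ` A) \<noteq> {}" using span_zero by blast
  show "c \<le> d"
    unfolding A(3) infdist_notempty[OF ne]
    using assms A ne by (intro cINF_greatest) (auto simp: dist_norm)
qed

section \<open>Greedy sums\<close>

context
  fixes e :: "nat \<Rightarrow> 'a::real_normed_vector"
  assumes sb: "schauder_basis e" and sn: "semi_normalized e"
begin

text \<open>The terms of the expansion tend to 0, and the positive lower bound for the norms of the
  basis vectors transfers this to the coordinates.\<close>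

lemma coord_tendsto_0: "(\<lambda>n. coord e n x) \<longlonglongrightarrow> 0"
proof -
  define c where "c = (INF n. norm (e n))"
  have c: "c > 0" using sn by (simp add: c_def semi_normalized_def)
  have ce: "c \<le> norm (e n)" for n
    unfolding c_def by (intro cINF_lower bdd_belowI2[of _ 0]) auto
  have "(\<lambda>n. coord e n x *\<^sub>R e n) \<longlonglongrightarrow> 0"
    using sums_summable[OF coord_sums[OF sb]] by (rule summable_LIMSEQ_zero)
  then have "(\<lambda>n. norm (coord e n x *\<^sub>R e n) / c) \<longlonglongrightarrow> 0"
    by (rule tendsto_divide_zero[OF tendsto_norm_zero])
  moreover have "norm (coord e n x) \<le> norm (coord e n x *\<^sub>R e n) / c" for n
    using mult_left_mono[OF ce[of n], of "\<bar>coord e n x\<bar>"] c by (simp add: field_simps)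
  then have "\<forall>\<^sub>F n in sequentially. norm (coord e n x) \<le> norm (coord e n x *\<^sub>R e n) / c"
    by (rule always_eventually[OF allI])
  ultimately show ?thesis by (rule Lim_null_comparison[rotated])
qed

lemma finite_coord_ge: "t > 0 \<Longrightarrow> finite {n. t \<le> \<bar>coord e n x\<bar>}"
proof -
  assume "t > 0"
  with coord_tendsto_0[of x] obtain N where "\<And>n. n \<ge> N \<Longrightarrow> \<bar>coord e n x\<bar> < t"
    by (auto simp: LIMSEQ_iff)
  then have "{n. t \<le> \<bar>coord e n x\<bar>} \<subseteq> {..<N}" by (auto simp: not_le[symmetric])
  then show ?thesis by (rule finite_subset) simp
qed

text \<open>The greedy order on \<open>S\<close> has finite initial segments. Predecessors of an
  index in the support have coordinates above a positive threshold; predecessors of a zero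
  coordinate lie in the support, then finite, or have smaller index.\<close>

lemma ex_natural_greedy_ordering: "\<exists>\<rho>. natural_greedy_ordering e x \<rho>"
proof -
  define lt where "lt j k \<longleftrightarrow> \<bar>coord e j x\<bar> > \<bar>coord e k x\<bar> \<or>
     (\<bar>coord e j x\<bar> = \<bar>coord e k x\<bar> \<and> j < k)" for j k
  \<comment> \<open>With infinitely many nonzero coordinates an enumeration would never reach a zero one.\<close>
  define S where "S = (if finite (supp e x) then UNIV else supp e x)"
  have S: "infinite S" "supp e x \<subseteq> S" by (auto simp: S_def)
  have fin: "finite {k \<in> S. lt k n}" if "n \<in> S" for n
  proof (cases "n \<in> supp e x")
    case True
    then have "finite {k. \<bar>coord e n x\<bar> \<le> \<bar>coord e k x\<bar>}"
      by (intro finite_coord_ge) (auto simp: supp_def)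
    then show ?thesis by (rule rev_finite_subset) (auto simp: lt_def)
  next
    case False
    with that have "finite (supp e x)" by (auto simp: S_def split: if_splits)
    then have "finite (supp e x \<union> {..<n})" by simp
    then show ?thesis
      by (rule rev_finite_subset) (use False in \<open>auto simp: lt_def supp_def\<close>)
  qed
  have tr: "lt a c" if "lt a b" "lt b c" for a b c using that by (auto simp: lt_def)
  have irr: "\<not> lt a a" for a by (simp add: lt_def)
  have tot: "lt a b \<or> lt b a" if "a \<noteq> b" for a b using that by (auto simp: lt_def)
  obtain \<rho> :: "nat \<Rightarrow> nat" where \<rho>: "bij_betw \<rho> UNIV S" "\<And>j k. j < k \<Longrightarrow> lt (\<rho> j) (\<rho> k)"
    by (rule enumerate_finite_predecessors[OF S(1)])
      (erule fin, erule (1) tr, rule irr, erule tot, blast)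
  have "inj \<rho>" "supp e x \<subseteq> range \<rho>" using \<rho>(1) S(2) by (simp_all add: bij_betw_def)
  moreover have "\<forall>j k. j < k \<longrightarrow> lt (\<rho> j) (\<rho> k)" using \<rho>(2) by blast
  ultimately have "natural_greedy_ordering e x \<rho>"
    unfolding natural_greedy_ordering_def lt_def by (intro conjI)
  then show ?thesis by (intro exI[of _ \<rho>])
qed

text \<open>Replaces the chosen ordering by a set. From here on a greedy sum is handled only through
  the size of \<open>G\<close> and the domination of outside coordinates by those on
  \<open>G\<close>.\<close>

lemma greedy_sum_eq_fin_proj:
  obtains G where "finite G" "card G = m" "greedy_sum e m x = fin_proj e G x"
    "\<And>n k. n \<in> G \<Longrightarrow> k \<notin> G \<Longrightarrow> \<bar>coord e k x\<bar> \<le> \<bar>coord e n x\<bar>"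
proof -
  define \<rho> where "\<rho> = (SOME \<rho>. natural_greedy_ordering e x \<rho>)"
  have "natural_greedy_ordering e x \<rho>"
    unfolding \<rho>_def using ex_natural_greedy_ordering by (rule someI_ex)
  then have inj: "inj \<rho>" and rng: "supp e x \<subseteq> range \<rho>"
    and "\<forall>j k. j < k \<longrightarrow> \<bar>coord e (\<rho> j) x\<bar> > \<bar>coord e (\<rho> k) x\<bar> \<or>
        (\<bar>coord e (\<rho> j) x\<bar> = \<bar>coord e (\<rho> k) x\<bar> \<and> \<rho> j < \<rho> k)"
    unfolding natural_greedy_ordering_def by simp_all
  then have ord: "\<bar>coord e (\<rho> k) x\<bar> \<le> \<bar>coord e (\<rho> j) x\<bar>" if "j < k" for j k
    using that by force
  show thesis
  proof (rule that[of "\<rho> ` {..<m}"])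
    show "card (\<rho> ` {..<m}) = m" using inj by (simp add: card_image inj_on_subset)
    show "greedy_sum e m x = fin_proj e (\<rho> ` {..<m}) x"
      unfolding greedy_sum_def fin_proj_def \<rho>_def[symmetric] Let_def
      using inj by (subst sum.reindex) (auto intro: inj_on_subset)
    fix n k assume n: "n \<in> \<rho> ` {..<m}" and k: "k \<notin> \<rho> ` {..<m}"
    show "\<bar>coord e k x\<bar> \<le> \<bar>coord e n x\<bar>"
    proof (cases "k \<in> range \<rho>")
      case True
      then obtain i where "k = \<rho> i" by blast
      with k have "m \<le> i" by (meson image_eqI lessThan_iff not_le)
      then show ?thesis using n ord \<open>k = \<rho> i\<close> by auto
    next
      case False
      with rng have "coord e k x = 0" by (auto simp: supp_def)
      then show ?thesis by simp
    qed
  qed simp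
qed

text \<open>Two distinct finite sets of equal size each contain an index missing from the other.
  Comparing these two indices contradicts the strict domination by \<open>B\<close>. This computes
  the greedy sums of test vectors.\<close>

lemma greedy_sum_eq_fin_proj_strict:
  assumes "finite B" "card B = m"
    and less: "\<And>n k. n \<in> B \<Longrightarrow> k \<notin> B \<Longrightarrow> \<bar>coord e k x\<bar> < \<bar>coord e n x\<bar>"
  shows "greedy_sum e m x = fin_proj e B x"
proof -
  obtain G where G: "finite G" "card G = m" "greedy_sum e m x = fin_proj e G x"
    "\<And>n k. n \<in> G \<Longrightarrow> k \<notin> G \<Longrightarrow> \<bar>coord e k x\<bar> \<le> \<bar>coord e n x\<bar>"
    using greedy_sum_eq_fin_proj by metis
  have "B = G"
  proof (rule ccontr)
    assume ne: "B \<noteq> G"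
    then have "\<not> B \<subseteq> G" using G assms by (metis card_subset_eq)
    moreover have "\<not> G \<subseteq> B" using ne G assms by (metis card_subset_eq)
    ultimately obtain n k where "n \<in> B" "n \<notin> G" "k \<in> G" "k \<notin> B" by blast
    with less[of n k] G(4)[of k n] show False by simp
  qed
  with G show ?thesis by simp
qed

section \<open>Unconditionality and democracy\<close>

lemma const_error_imp_bounded_fin_proj:
  assumes C: "C > 0"
    and le: "\<And>x m. m \<ge> 1 \<Longrightarrow> norm (x - greedy_sum e m x) \<le> C * const_error e m x"
  shows "bounded_fin_proj e (1 + C)"
  unfolding bounded_fin_proj_def
proof (intro allI impI)
  fix B :: "nat set" and x assume B: "finite B"
  show "norm (fin_proj e B x) \<le> (1 + C) * norm x"
  proof (cases "B = {}")
    case True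
    then show ?thesis using C by (simp add: fin_proj_def)
  next
    case False
    obtain M where M: "\<And>n. \<bar>coord e n x\<bar> \<le> M"
      using convergent_imp_Bseq[OF convergentI[OF coord_tendsto_0[of x]]]
      by (auto simp: Bseq_def)
    \<comment> \<open>The coordinates of \<open>y\<close> have modulus at least \<open>M + 1\<close>
      on \<open>B\<close> and at most \<open>M\<close> off it, so \<open>B\<close> is strictly
      greedy.\<close>
    define y where "y = x + (2 * M + 1) *\<^sub>R unit_sum e B"
    have cy: "coord e n y = coord e n x + (if n \<in> B then 2 * M + 1 else 0)" for n
      using B by (simp add: y_def coord_add[OF sb] coord_scaleR[OF sb] coord_unit_sum[OF sb])
    have "greedy_sum e (card B) y = fin_proj e B y"
    proof (rule greedy_sum_eq_fin_proj_strict)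
      fix n k assume "n \<in> B" "k \<notin> B"
      then show "\<bar>coord e k y\<bar> < \<bar>coord e n y\<bar>" using M[of n] M[of k] by (simp add: cy)
    qed (use B in auto)
    also have "fin_proj e B y = fin_proj e B x + (2 * M + 1) *\<^sub>R unit_sum e B"
      unfolding fin_proj_def unit_sum_def
      by (simp add: cy scaleR_add_left sum.distrib scaleR_sum_right)
    finally have "y - greedy_sum e (card B) y = x - fin_proj e B x" by (simp add: y_def)
    moreover have "card B \<ge> 1" using False B by (simp add: Suc_le_eq card_gt_0_iff)
    ultimately have "norm (x - fin_proj e B x) \<le> C * const_error e (card B) y"
      using le by metis
    \<comment> \<open>Approximating \<open>y\<close> by the multiple of \<open>unit_sum e B\<close>
      that was added leaves exactly \<open>x\<close>.\<close>
    also have "\<dots> \<le> C * norm (y - (2 * M + 1) *\<^sub>R unit_sum e B)"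
      using B C by (intro mult_left_mono const_error_le) auto
    finally have "norm (x - fin_proj e B x) \<le> C * norm x" by (simp add: y_def)
    then show ?thesis
      using norm_triangle_ineq4[of x "x - fin_proj e B x"] by (simp add: algebra_simps)
  qed
qed

lemma const_error_imp_democratic_basis:
  assumes C: "C > 0"
    and le: "\<And>x m. m \<ge> 1 \<Longrightarrow> norm (x - greedy_sum e m x) \<le> C * const_error e m x"
  shows "democratic_basis e"
proof (rule democratic_basisI_disjoint)
  show "C * 2 > 0" using C by simp
  fix A B :: "nat set" assume AB: "finite A" "finite B" "card A = card B" "A \<inter> B = {}"
  show "norm (unit_sum e A) \<le> C * 2 * norm (unit_sum e B)"
  proof (cases "A = {}")
    case True
    then show ?thesis using C by (simp add: unit_sum_def)
  next
    case False
    \<comment> \<open>The coefficient 2 makes \<open>B\<close> the greedy set, with remainder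
      \<open>unit_sum e A\<close>. Since \<open>A\<close> has the same size,
      \<open>unit_sum e A\<close> is also an admissible approximant, with remainder
      \<open>2 *\<^sub>R unit_sum e B\<close>.\<close>
    define y where "y = unit_sum e A + 2 *\<^sub>R unit_sum e B"
    have cy: "coord e n y = (if n \<in> A then 1 else 0) + (if n \<in> B then 2 else 0)" for n
      using AB by (simp add: y_def coord_add[OF sb] coord_scaleR[OF sb] coord_unit_sum[OF sb])
    have "greedy_sum e (card B) y = fin_proj e B y"
      by (rule greedy_sum_eq_fin_proj_strict) (use AB in \<open>auto simp: cy\<close>)
    also have "fin_proj e B y = 2 *\<^sub>R unit_sum e B"
      unfolding fin_proj_def unit_sum_def scaleR_sum_right
      using AB by (intro sum.cong) (auto simp: cy)
    finally have "y - greedy_sum e (card B) y = unit_sum e A" by (simp add: y_def)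
    moreover have "card B \<ge> 1" using False AB by (simp add: Suc_le_eq card_gt_0_iff flip: AB(3))
    ultimately have "norm (unit_sum e A) \<le> C * const_error e (card B) y"
      using le by metis
    also have "\<dots> \<le> C * norm (y - 1 *\<^sub>R unit_sum e A)"
      using AB C by (intro mult_left_mono const_error_le) auto
    finally show ?thesis by (simp add: y_def)
  qed
qed

lemma unconditional_democratic_imp_greedy_basis:
  assumes "unconditional_basis e" "democratic_basis e"
  shows "greedy_basis e"
proof -
  obtain K where K: "K > 0" "bounded_fin_proj e K"
    using unconditional_basis_imp_bounded_fin_proj assms(1) by blast
  obtain D where D: "D \<ge> 1" "\<And>A B. finite A \<Longrightarrow> finite B \<Longrightarrow> card A = card B
      \<Longrightarrow> norm (unit_sum e A) \<le> D * norm (unit_sum e B)"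
    using assms(2) unfolding democratic_basis_def by blast
  \<comment> \<open>\<open>1 + K\<close> pays for the part of \<open>x\<close> outside
    \<open>A \<union> G\<close>, and the last summand for the part on \<open>A - G\<close>.\<close>
  define C where "C = 1 + K + 4 * K^3 * D"
  have C: "C \<ge> 1" using K D by (simp add: C_def)
  have est: "norm (x - greedy_sum e m x) \<le> C * norm (x - v)"
    if A: "finite A" "card A = m" and v: "v \<in> span (e ` A)" for x m A v
  proof -
    obtain G where G: "finite G" "card G = m" "greedy_sum e m x = fin_proj e G x"
      "\<And>n k. n \<in> G \<Longrightarrow> k \<notin> G \<Longrightarrow> \<bar>coord e k x\<bar> \<le> \<bar>coord e n x\<bar>"
      using greedy_sum_eq_fin_proj by metis
    have sv: "supp e v \<subseteq> A" using supp_span_subset[OF sb v] .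
    have pv: "fin_proj e (A \<union> G) v = v" using sv A G by (intro fin_proj_eq_self[OF sb]) auto
    have "fin_proj e (G \<union> (A - G)) x = fin_proj e G x + fin_proj e (A - G) x"
      using A G by (intro fin_proj_Un) auto
    \<comment> \<open>Since \<open>v\<close> is fixed by the projection onto
      \<open>A \<union> G\<close>, it cancels in the first bracket, which is \<open>x\<close> minus
      its projection onto \<open>A \<union> G\<close>. The second term restores the coordinates on
      \<open>A - G\<close>.\<close>
    then have decomp: "x - fin_proj e G x
        = ((x - v) - fin_proj e (A \<union> G) (x - v)) + fin_proj e (A - G) x"
      by (simp add: fin_proj_diff[OF sb] pv Un_commute)
    have "norm (fin_proj e (A \<union> G) (x - v)) \<le> K * norm (x - v)"
      using A G by (intro bounded_fin_projD[OF K(2)]) auto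
    then have "norm ((x - v) - fin_proj e (A \<union> G) (x - v)) \<le> norm (x - v) + K * norm (x - v)"
      using norm_triangle_ineq4[of "x - v" "fin_proj e (A \<union> G) (x - v)"] by linarith
    moreover have "norm (fin_proj e (A - G) x) \<le> 4 * K^3 * D * norm (x - v)"
    proof -
      have card: "card (A - G) = card (G - A)"
        using A G card_Diff_subset_Int[of A G] card_Diff_subset_Int[of G A]
        by (simp add: Int_commute)
      \<comment> \<open>\<open>t\<close> separates the two sets: it is the largest modulus on
        \<open>A - G\<close>, and by greediness no coordinate on \<open>G - A\<close> is smaller.
        There \<open>v\<close> vanishes, so the same holds for \<open>x - v\<close>. The value 0
        covers the empty set, where \<open>Max\<close> is unspecified.\<close>
      define t where "t = (if A - G = {} then 0 else Max ((\<lambda>n. \<bar>coord e n x\<bar>) ` (A - G)))"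
      have tmax: "\<bar>coord e n x\<bar> \<le> t" if "n \<in> A - G" for n
        using that A by (auto simp: t_def intro!: Max_ge)
      have tlarge: "t \<le> \<bar>coord e n (x - v)\<bar>" if "n \<in> G - A" for n
      proof (cases "A - G = {}")
        case False
        then have "t \<in> (\<lambda>n. \<bar>coord e n x\<bar>) ` (A - G)"
          unfolding t_def using A by (simp only: if_False) (intro Max_in, auto)
        then obtain k where "k \<in> A - G" "t = \<bar>coord e k x\<bar>" by blast
        moreover have "coord e n v = 0" using sv that by (auto simp: supp_def)
        ultimately show ?thesis using that G(4)[of n k] by (simp add: coord_diff[OF sb])
      qed (simp add: t_def)
      have "0 \<le> t"
      proof (cases "A - G = {}")
        case False
        then obtain k where "k \<in> A - G" by blast
        from tmax[OF this] show ?thesis by linarith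
      qed (simp add: t_def)
      then show ?thesis
        using A G card tmax tlarge D
        by (intro norm_fin_proj_exchange[OF sb K(2,1) D(2), where B = "G - A"]) auto
    qed
    ultimately have "norm (x - fin_proj e G x)
        \<le> norm (x - v) + K * norm (x - v) + 4 * K^3 * D * norm (x - v)"
      unfolding decomp by (intro norm_triangle_le add_mono)
    then show ?thesis by (simp add: G(3) C_def algebra_simps)
  qed
  have "norm (x - greedy_sum e m x) \<le> C * best_error e m x" for x m
  proof -
    \<comment> \<open>Dividing by \<open>C\<close> gives a lower bound for each single error, hence
      for their infimum.\<close>
    have "norm (x - greedy_sum e m x) / C \<le> best_error e m x"
      using est C by (intro le_best_errorI) (simp add: divide_le_eq mult.commute)
    then show ?thesis using C by (simp add: divide_le_eq mult.commute)
  qed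
  with C show ?thesis unfolding greedy_basis_def by blast
qed

end

section \<open>Property (Q) and its starred form\<close>

context
  fixes e :: "nat \<Rightarrow> 'a::real_normed_vector"
  assumes sb: "schauder_basis e"
begin

text \<open>\<open>x\<close> is a finite projection of \<open>x + y\<close>, and \<open>z\<close> is
  exchanged for coordinates of \<open>y\<close> of modulus 1, which survive in \<open>x + y\<close>
  because the supports are disjoint. The two estimates are added.\<close>

lemma unconditional_democratic_imp_property_Q_star:
  assumes "unconditional_basis e" "democratic_basis e"
  shows "\<exists>C>0. property_Q_star e C"
proof -
  obtain K where K: "K > 0" "bounded_fin_proj e K"
    using unconditional_basis_imp_bounded_fin_proj assms(1) by blast
  obtain D where D: "D \<ge> 1" "\<And>A B. finite A \<Longrightarrow> finite B \<Longrightarrow> card A = card B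
      \<Longrightarrow> norm (unit_sum e A) \<le> D * norm (unit_sum e B)"
    using assms(2) unfolding democratic_basis_def by blast
  define C where "C = K + 4 * K^3 * D"
  have "C > 0" using K D by (simp add: C_def add_pos_pos)
  moreover have "norm (x + z) \<le> C * norm (x + y)"
    if x: "x \<in> finsupp_vectors e" and z: "z \<in> finsupp_vectors e" and y: "y \<in> finsupp_vectors e"
      and xz: "disj_supp e x z" and xy: "disj_supp e x y"
      and zle: "coord_sup_norm e z \<le> 1" and yz: "y \<in> Gamma_set e z" for x y z
  proof -
    have fin: "finite (supp e x)" "finite (supp e y)" "finite (supp e z)"
      using x y z by (auto simp: finsupp_vectors_def)
    have "fin_proj e (supp e x) (x + y) = x"
      using xy fin by (simp add: fin_proj_add[OF sb] fin_proj_eq_self[OF sb] fin_proj_eq_0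
          disj_supp_def Int_commute)
    then have "norm x \<le> K * norm (x + y)" using bounded_fin_projD[OF K(2) fin(1)] by metis
    moreover have "norm z \<le> 4 * K^3 * D * norm (x + y)"
    \<comment> \<open>\<open>Gamma_set e 0\<close> gives no count of unit coordinates, so
      \<open>z = 0\<close> is treated apart.\<close>
    proof (cases "z = 0")
      case True
      then show ?thesis using K D by simp
    next
      case False
      then have "card (supp e z) \<le> card {n. \<bar>coord e n y\<bar> = 1}"
        using yz by (simp add: Gamma_set_def)
      then obtain H where H: "H \<subseteq> {n. \<bar>coord e n y\<bar> = 1}" "card H = card (supp e z)" "finite H"
        by (rule obtain_subset_with_card_n)
      have "norm (fin_proj e (supp e z) z) \<le> 4 * K^3 * D * norm (x + y)"
      proof (rule norm_fin_proj_exchange[OF sb K(2,1) D(2), where B = H and t = 1])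
        show "\<bar>coord e n z\<bar> \<le> 1" for n
          using abs_coord_le_coord_sup_norm[OF z] zle by (rule order_trans)
        fix n assume "n \<in> H"
        then have n: "\<bar>coord e n y\<bar> = 1" using H by auto
        then have "coord e n x = 0" using xy by (auto simp: disj_supp_def supp_def)
        with n show "1 \<le> \<bar>coord e n (x + y)\<bar>" by (simp add: coord_add[OF sb])
      qed (use H D fin in auto)
      then show ?thesis using fin by (simp add: fin_proj_eq_self[OF sb])
    qed
    ultimately have "norm (x + z) \<le> K * norm (x + y) + 4 * K^3 * D * norm (x + y)"
      by (intro norm_triangle_le add_mono)
    then show ?thesis by (simp add: C_def algebra_simps)
  qed
  ultimately show ?thesis unfolding property_Q_star_def by (intro exI[of _ C]) auto
qed

text \<open>The starred property is applied to \<open>unit_sum e A\<close> and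
  \<open>y + unit_sum e B\<close>. As \<open>y\<close> vanishes on \<open>B\<close>, the second
  vector has coordinate 1 there, and \<open>B\<close> is large enough for membership in
  \<open>Gamma_set\<close>.\<close>

lemma property_Q_star_imp_property_Q:
  assumes "property_Q_star e C"
  shows "property_Q e C"
  unfolding property_Q_def
proof (intro allI ballI impI, elim conjE)
  fix A B x y
  assume x: "x \<in> finsupp_vectors e" and y: "y \<in> finsupp_vectors e"
    and AB: "finite A" "finite B" "card A = card B" "A \<inter> B = {}"
    and xy: "disj_supp e x y" and xle: "coord_sup_norm e x \<le> 1"
    and s: "supp e (x + y) \<inter> (A \<union> B) = {}"
  \<comment> \<open>Disjoint supports cannot cancel, so the condition on \<open>x + y\<close> holds
    for each of \<open>x\<close> and \<open>y\<close>.\<close>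
  have s': "(supp e x \<union> supp e y) \<inter> (A \<union> B) = {}"
    using s supp_add_disjoint[OF sb xy] by simp
  define z w where "z = unit_sum e A" and "w = y + unit_sum e B"
  have sz: "supp e z = A" using AB by (simp add: z_def supp_unit_sum[OF sb])
  have sw: "supp e w \<subseteq> supp e y \<union> B"
    using supp_add_subset[OF sb, of y "unit_sum e B"] AB by (simp add: w_def supp_unit_sum[OF sb])
  have zX: "z \<in> finsupp_vectors e" using AB sz by (simp add: finsupp_vectors_def)
  have finw: "finite (supp e w)"
    using sw y AB by (auto simp: finsupp_vectors_def intro: finite_subset)
  have "B \<subseteq> {n. \<bar>coord e n w\<bar> = 1}"
  proof
    fix n assume n: "n \<in> B"
    then have "coord e n y = 0" using s' by (auto simp: supp_def)
    then show "n \<in> {n. \<bar>coord e n w\<bar> = 1}"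
      using n AB by (simp add: w_def coord_add[OF sb] coord_unit_sum[OF sb])
  qed
  moreover have "finite {n. \<bar>coord e n w\<bar> = 1}"
    using finw by (rule rev_finite_subset) (auto simp: supp_def)
  ultimately have "card (supp e z) \<le> card {n. \<bar>coord e n w\<bar> = 1}"
    using AB sz card_mono by simp
  moreover have "disj_supp e z w" using sz sw s' AB by (auto simp: disj_supp_def)
  ultimately have "w \<in> Gamma_set e z" using finw by (simp add: Gamma_set_def finsupp_vectors_def)
  moreover have "disj_supp e x z" "disj_supp e x w"
    using sz sw s' xy by (auto simp: disj_supp_def)
  moreover have "coord_sup_norm e z \<le> 1"
    using AB by (intro coord_sup_norm_le) (simp add: z_def coord_unit_sum[OF sb])
  ultimately have "norm (x + z) \<le> C * norm (x + w)"
    using assms x zX finw xle unfolding property_Q_star_def finsupp_vectors_def by simp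
  then show "norm (x + unit_sum e A) \<le> C * norm (x + y + unit_sum e B)"
    by (simp add: z_def w_def add.assoc)
qed

text \<open>Property (Q) with both sets empty compares \<open>x\<close> with \<open>x + y\<close>.
  Taking for \<open>x\<close> the part on \<open>F\<close> of a vector and for \<open>y\<close> the
  rest gives a projection bound.\<close>

lemma property_Q_imp_bounded_fin_proj:
  assumes C: "C > 0" and Q: "property_Q e C"
  shows "bounded_fin_proj e C"
proof (rule bounded_fin_projI_finsupp[OF sb])
  fix F :: "nat set" and w assume F: "finite F" and w: "w \<in> finsupp_vectors e"
  \<comment> \<open>Scales the coordinates of \<open>w\<close> to modulus at most 1; the added 1
    keeps the denominator positive for \<open>w = 0\<close>. The factor cancels at the end by
    homogeneity.\<close>
  define c where "c = 1 / (1 + coord_sup_norm e w)"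
  have le: "\<bar>coord e n w\<bar> \<le> coord_sup_norm e w" for n
    by (rule abs_coord_le_coord_sup_norm[OF w])
  have sup: "0 \<le> coord_sup_norm e w" using le[of 0] by linarith
  then have c: "c > 0" by (simp add: c_def)
  define x y where "x = c *\<^sub>R fin_proj e F w" and "y = c *\<^sub>R (w - fin_proj e F w)"
  have cx: "coord e n x = (if n \<in> F then c * coord e n w else 0)"
    and cy: "coord e n y = (if n \<in> F then 0 else c * coord e n w)" for n
    using F by (auto simp: x_def y_def coord_scaleR[OF sb] coord_diff[OF sb] coord_fin_proj[OF sb])
  have "x \<in> finsupp_vectors e" "y \<in> finsupp_vectors e"
    using w unfolding finsupp_vectors_def supp_def
    by (auto simp: cx cy elim!: rev_finite_subset split: if_splits)
  moreover have "disj_supp e x y" by (auto simp: disj_supp_def supp_def cx cy)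
  moreover have "coord_sup_norm e x \<le> 1"
  proof (rule coord_sup_norm_le)
    fix n
    have "c * \<bar>coord e n w\<bar> \<le> 1" using le[of n] sup by (simp add: c_def divide_le_eq)
    then show "\<bar>coord e n x\<bar> \<le> 1" using c by (simp add: cx abs_mult)
  qed
  ultimately have "norm (x + unit_sum e {}) \<le> C * norm (x + y + unit_sum e {})"
    using Q unfolding property_Q_def by blast
  moreover have "x + y = c *\<^sub>R w" by (simp add: x_def y_def algebra_simps)
  ultimately have "c * norm (fin_proj e F w) \<le> c * (C * norm w)"
    using c by (simp add: x_def unit_sum_def mult_ac)
  then show "norm (fin_proj e F w) \<le> C * norm w" using c by simp
qed (use C in simp)

text \<open>The case \<open>x = y = 0\<close> of property (Q) is democracy for disjoint
  sets.\<close>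

lemma property_Q_imp_democratic_basis:
  assumes C: "C > 0" and Q: "property_Q e C"
  shows "democratic_basis e"
proof (rule democratic_basisI_disjoint[OF C])
  fix A B :: "nat set"
  assume AB: "finite A" "finite B" "card A = card B" "A \<inter> B = {}"
  have "coord_sup_norm e 0 \<le> 1" by (rule coord_sup_norm_le) (simp add: coord_zero[OF sb])
  moreover have "0 \<in> finsupp_vectors e" "disj_supp e 0 0" "supp e (0 + 0) \<inter> (A \<union> B) = {}"
    by (simp_all add: finsupp_vectors_def disj_supp_def supp_zero[OF sb])
  ultimately have "norm (0 + unit_sum e A) \<le> C * norm (0 + 0 + unit_sum e B)"
    using Q AB unfolding property_Q_def by blast
  then show "norm (unit_sum e A) \<le> C * norm (unit_sum e B)" by simp
qed

end

section \<open>The two cycles of implications\<close>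

theorem corollary1p8:
  fixes e :: "nat \<Rightarrow> 'a::banach"
  assumes "schauder_basis e" and "semi_normalized e"
  shows
    "(greedy_basis e \<longleftrightarrow>
        (\<exists>C>0. \<forall>x. \<forall>m\<ge>1. norm (x - greedy_sum e m x) \<le> C * signed_const_error e m x)) \<and>
     (greedy_basis e \<longleftrightarrow>
        (\<exists>C>0. \<forall>x. \<forall>m\<ge>1. norm (x - greedy_sum e m x) \<le> C * const_error e m x)) \<and>
     (greedy_basis e \<longleftrightarrow> (\<exists>C>0. property_Q e C)) \<and>
     (greedy_basis e \<longleftrightarrow> (\<exists>C>0. property_Q_star e C)) \<and>
     (greedy_basis e \<longleftrightarrow> unconditional_basis e \<and> democratic_basis e)"
    (is "(_ \<longleftrightarrow> ?ii) \<and> (_ \<longleftrightarrow> ?iii) \<and> (_ \<longleftrightarrow> ?iv) \<and> (_ \<longleftrightarrow> ?v) \<and> (_ \<longleftrightarrow> ?vi)")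
proof -
  have "?ii" if "greedy_basis e"
  proof -
    obtain C where C: "C \<ge> 1" "\<And>x m. m \<ge> 1 \<Longrightarrow> norm (x - greedy_sum e m x) \<le> C * best_error e m x"
      using \<open>greedy_basis e\<close> unfolding greedy_basis_def by blast
    have "C * best_error e m x \<le> C * signed_const_error e m x" for m x
      using C(1) by (intro mult_left_mono best_error_le_signed_const_error) auto
    with C(2) have "\<forall>x. \<forall>m\<ge>1. norm (x - greedy_sum e m x) \<le> C * signed_const_error e m x"
      by (blast intro: order_trans)
    moreover have "C > 0" using C(1) by simp
    ultimately show ?thesis by blast
  qed
  moreover have "?iii" if ii: "?ii"
  proof -
    obtain C where C: "C > 0"
      "\<And>x m. m \<ge> 1 \<Longrightarrow> norm (x - greedy_sum e m x) \<le> C * signed_const_error e m x"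
      using ii by blast
    have "C * signed_const_error e m x \<le> C * const_error e m x" for m x
      using C(1) by (intro mult_left_mono signed_const_error_le_const_error) auto
    with C(2) have "\<forall>x. \<forall>m\<ge>1. norm (x - greedy_sum e m x) \<le> C * const_error e m x"
      by (blast intro: order_trans)
    moreover have "C > 0" using C(1) by simp
    ultimately show ?thesis by blast
  qed
  moreover have "?vi" if "?iii"
    using that const_error_imp_bounded_fin_proj[OF assms] const_error_imp_democratic_basis[OF assms]
      bounded_fin_proj_imp_unconditional_basis[OF assms(1)] by blast
  moreover have "greedy_basis e" if "?vi"
    using that unconditional_democratic_imp_greedy_basis[OF assms] by blast
  moreover have "?v" if "?vi"
    using that unconditional_democratic_imp_property_Q_star[OF assms(1)] by blast
  moreover have "?iv" if "?v"
    using that property_Q_star_imp_property_Q[OF assms(1)] by blast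
  moreover have "?vi" if "?iv"
    using that property_Q_imp_bounded_fin_proj[OF assms(1)] property_Q_imp_democratic_basis[OF assms(1)]
      bounded_fin_proj_imp_unconditional_basis[OF assms(1)] by blast
  ultimately show ?thesis by argo
qed

end
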